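(* Every odd-quadratic Lie superalgebra $(\mathfrak g,B)$ of weak filiform type with $\dim\mathfrak g_{\bar 1}\ge 3$ is obtained from a $6$-dimensional odd-quadratic Lie superalgebra of weak filiform type (with even basis $\{X_1,X_2,X_3\}$ and odd basis $\{e_3,v_2,u_2\}$) by a finite sequence of generalized odd double extensions by one-dimensional Lie superalgebras and/or (orthogonal) direct sums of them.
   Context: All Lie superalgebras are finite-dimensional over an algebraically closed field $\mathbb K$ of characteristic zero. A Lie superalgebra $\mathfrak g=\mathfrak g_{\bar 0}\oplus\mathfrak g_{\bar 1}$ is odd-quadratic, written $(\mathfrak g,B)$, if it carries a bilinear form $B:\mathfrak g\times\mathfrak g\to\mathbb K$ (an odd-invariant scalar product) that is supersymmetric ($B(X,Y)=(-1)^{ij}B(Y,X)$ for $X\in\mathfrak g_{\bar i},Y\in\mathfrak g_{\bar j}$), invariant ($B([X,Y],Z)=B(X,[Y,Z])$), odd ($B(\mathfrak g_{\bar 0},\mathfrak g_{\bar 0})=B(\mathfrak g_{\bar 1},\mathfrak g_{\bar 1})=0$) and non-degenerate; then $\dim\mathfrak g_{\bar 0}=\dim\mathfrak g_{\bar 1}$. A Lie superalgebra $\mathfrak g$ with $\dim\mathfrak g_{\bar 1}=m>0$ is of weak filiform type if there is a flag of subspaces $\mathfrak g_{\bar 1}=V_m\supset V_{m-1}\supset\dots\supset V_2\supset V_1=\{0\}$ with $\dim V_i=i$ and $[\mathfrak g_{\bar 0},V_i]=V_{i-1}$ for all $i\in\{2,\dots,m\}$, where $[\mathfrak g_{\bar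 0},V_i]$ denotes the linear span of brackets (the flag jumps from dimension $2$ to dimension $0$). One writes $V_2=\mathbb Ku_2\oplus\mathbb Kv_2$ and $V_i/V_{i-1}=\mathbb Ke_i$ with $e_i\in V_i$ for $3\le i\le m$. Generalized odd double extension: let $(\mathfrak h,\widetilde B)$ be an odd-quadratic Lie superalgebra, $D$ an odd skew-supersymmetric superderivation of it, i.e. an odd linear map with $D([X,Y])=[D(X),Y]+(-1)^{i}[X,D(Y)]$ and $\widetilde B(D(X),Y)=-(-1)^{i}\widetilde B(X,D(Y))$ for $X\in\mathfrak h_{\bar i}$, $Y\in\mathfrak h$, and let $X_0\in\mathfrak h_{\bar 0}$, $\lambda_0\in\mathbb K$ satisfy $D(X_0)=0$ and $D^2=\frac12[X_0,\cdot]_{\mathfrak h}$. (When $\mathfrak h_{\bar 1}$ is weak filiform with flag $V_n\supset\dots\supset V_2\supset V_1=\{0\}$, $n\ge 3$, the construction in the paper also requires $e_n\in D(\mathfrak h_{\bar 0})$ for a vector $e_n$ with $V_n/V_{n-1}=\mathbb Ke_n$.) The generalized odd double extension of $(\mathfrak h,\widetilde B)$ by the one-dimensional Lie superalgebra $(\mathbb Ke)_{\bar 1}$ (with $e$ odd), by means of $D,X_0,\lambda_0$, is $\mathfrak t=\mathbb Ke\oplus\mathfrak h\oplus\mathbb Ke^*$ with $e$ odd and $e^*$ even, with bracket $[e,e]=X_0+\lambda_0e^*$, $[e,X]=D(X)-(-1)^{i}\widetilde B(X,X_0)e^*$ for $X\in\mathfrak h_{\bar i}$, $[X,Y]=[X,Y]_{\mathfrak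 h}+\widetilde B(D(X),Y)e^*$ for $X,Y\in\mathfrak h$, $[e^*,\mathfrak t]=0$, and with the odd-invariant scalar product that restricts to $\widetilde B$ on $\mathfrak h$, pairs $e$ and $e^*$ to $1$, and makes $\mathfrak h$ orthogonal to $e$ and $e^*$. *)

theory Defs
  imports Complex_Main "HOL-Library.Z2" "HOL-Computational_Algebra.Polynomial"
begin

text \<open>
  Superalgebras live on graded subspaces of an ambient vector space. The type \<open>bit\<close> is
  $\mathbb{Z}/2\mathbb{Z}$, so \<open>homog g i\<close> is the homogeneous component of parity \<open>i\<close>. Bracket
  and form are functions on the whole ambient type, but only their values on the carrier matter.
\<close>

record 'v superalg =
  homog :: "bit \<Rightarrow> 'v set"
  brk :: "'v \<Rightarrow> 'v \<Rightarrow> 'v"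

text \<open>The sign $(-1)^i$; the sign $(-1)^{ij}$ is \<open>psign (i * j)\<close>.\<close>

definition psign :: "bit \<Rightarrow> 'k::ring_1"
  where "psign i = (if i = 0 then 1 else - 1)"

definition superspace_of :: "'v::ab_group_add superalg \<Rightarrow> 'v set"
  where "superspace_of g = {x + y | x y. x \<in> homog g 0 \<and> y \<in> homog g 1}"

text \<open>A locale of its own because the interpretation of \<open>vector_space\<close> by \<open>scaleR\<close> would shadow the
  names below. It adds no assumptions to \<open>vector_space\<close>.\<close>

locale superalg_space = vector_space scale
  for scale :: "'a::{alg_closed_field, field_char_0} \<Rightarrow> 'b::ab_group_add \<Rightarrow> 'b" (infixr \<open>*s\<close> 75)
begin

definition linear_map_on :: "'b set \<Rightarrow> ('a \<Rightarrow> 'w \<Rightarrow> 'w) \<Rightarrow> ('b \<Rightarrow> 'w::ab_group_add) \<Rightarrow> bool"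
  where "linear_map_on S s f \<longleftrightarrow>
    (\<forall>x\<in>S. \<forall>y\<in>S. f (x + y) = f x + f y) \<and> (\<forall>c. \<forall>x\<in>S. f (c *s x) = s c (f x))"

definition bilinear_map_on ::
    "'b set \<Rightarrow> ('a \<Rightarrow> 'w \<Rightarrow> 'w) \<Rightarrow> ('b \<Rightarrow> 'b \<Rightarrow> 'w::ab_group_add) \<Rightarrow> bool"
  where "bilinear_map_on S s f \<longleftrightarrow>
    (\<forall>x\<in>S. linear_map_on S s (f x)) \<and> (\<forall>y\<in>S. linear_map_on S s (\<lambda>x. f x y))"

definition basis_of :: "'b set \<Rightarrow> 'b list \<Rightarrow> bool"
  where "basis_of S xs \<longleftrightarrow> distinct xs \<and> independent (set xs) \<and> span (set xs) = S"

text \<open>The last condition is the super Jacobi identity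
  $[X,[Y,Z]] = [[X,Y],Z] + (-1)^{ij}[Y,[X,Z]]$.\<close>

definition lie_superalgebra :: "'b superalg \<Rightarrow> bool"
  where "lie_superalgebra g \<longleftrightarrow>
    (\<forall>i. subspace (homog g i) \<and> (\<exists>S. finite S \<and> span S = homog g i)) \<and>
    homog g 0 \<inter> homog g 1 = {0} \<and>
    bilinear_map_on (superspace_of g) scale (brk g) \<and>
    (\<forall>i j. \<forall>X\<in>homog g i. \<forall>Y\<in>homog g j. brk g X Y \<in> homog g (i + j)) \<and>
    (\<forall>i j. \<forall>X\<in>homog g i. \<forall>Y\<in>homog g j. brk g X Y = - psign (i * j) *s brk g Y X) \<and>
    (\<forall>i j k. \<forall>X\<in>homog g i. \<forall>Y\<in>homog g j. \<forall>Z\<in>homog g k.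
      brk g X (brk g Y Z) = brk g (brk g X Y) Z + psign (i * j) *s brk g Y (brk g X Z))"

definition odd_quadratic :: "'b superalg \<Rightarrow> ('b \<Rightarrow> 'b \<Rightarrow> 'a) \<Rightarrow> bool"
  where "odd_quadratic g B \<longleftrightarrow>
    lie_superalgebra g \<and>
    bilinear_map_on (superspace_of g) (*) B \<and>
    (\<forall>i j. \<forall>X\<in>homog g i. \<forall>Y\<in>homog g j. B X Y = psign (i * j) * B Y X) \<and>
    (\<forall>X\<in>superspace_of g. \<forall>Y\<in>superspace_of g. \<forall>Z\<in>superspace_of g.
      B (brk g X Y) Z = B X (brk g Y Z)) \<and>
    (\<forall>i. \<forall>X\<in>homog g i. \<forall>Y\<in>homog g i. B X Y = 0) \<and>
    (\<forall>X\<in>superspace_of g. (\<forall>Y\<in>superspace_of g. B X Y = 0) \<longrightarrow> X = 0)"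

text \<open>The flag of a weak filiform algebra jumps from dimension \<open>2\<close> (\<open>V 2\<close>) to dimension \<open>0\<close>
  (\<open>V 1\<close>); there is no dimension requirement at index \<open>1\<close>.\<close>

definition weak_filiform_flag :: "'b superalg \<Rightarrow> (nat \<Rightarrow> 'b set) \<Rightarrow> bool"
  where "weak_filiform_flag g V \<longleftrightarrow>
    dim (homog g 1) > 0 \<and> V (dim (homog g 1)) = homog g 1 \<and> V 1 = {0} \<and>
    (\<forall>i\<in>{2..dim (homog g 1)}.
      subspace (V i) \<and> dim (V i) = i \<and> V (i - 1) \<subset> V i \<and>
      span {brk g X v | X v. X \<in> homog g 0 \<and> v \<in> V i} = V (i - 1))"

definition weak_filiform :: "'b superalg \<Rightarrow> bool"
  where "weak_filiform g \<longleftrightarrow> (\<exists>V. weak_filiform_flag g V)"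

definition odd_superderivation :: "'b superalg \<Rightarrow> ('b \<Rightarrow> 'b) \<Rightarrow> bool"
  where "odd_superderivation h D \<longleftrightarrow>
    linear_map_on (superspace_of h) scale D \<and>
    (\<forall>i. D ` homog h i \<subseteq> homog h (i + 1)) \<and>
    (\<forall>i. \<forall>X\<in>homog h i. \<forall>Y\<in>superspace_of h.
      D (brk h X Y) = brk h (D X) Y + psign i *s brk h X (D Y))"

definition skew_supersymmetric :: "'b superalg \<Rightarrow> ('b \<Rightarrow> 'b \<Rightarrow> 'a) \<Rightarrow> ('b \<Rightarrow> 'b) \<Rightarrow> bool"
  where "skew_supersymmetric h B D \<longleftrightarrow>
    (\<forall>i. \<forall>X\<in>homog h i. \<forall>Y\<in>superspace_of h. B (D X) Y = - psign i * B X (D Y))"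

text \<open>The last condition concerns only weak filiform \<open>h\<close>: membership in \<open>V n - V (n - 1)\<close> says
  that the vector represents a generator of the one-dimensional quotient \<open>V n / V (n - 1)\<close>.\<close>

definition double_extension_data ::
    "'b superalg \<Rightarrow> ('b \<Rightarrow> 'b \<Rightarrow> 'a) \<Rightarrow> ('b \<Rightarrow> 'b) \<Rightarrow> 'b \<Rightarrow> bool"
  where "double_extension_data h B D X0 \<longleftrightarrow>
    odd_quadratic h B \<and> odd_superderivation h D \<and> skew_supersymmetric h B D \<and>
    X0 \<in> homog h 0 \<and> D X0 = 0 \<and>
    (\<forall>X\<in>superspace_of h. D (D X) = (1 / 2) *s brk h X0 X) \<and>
    (\<forall>V. let n = dim (homog h 1) in
      weak_filiform_flag h V \<and> n \<ge> 3 \<longrightarrow> (\<exists>e\<^sub>n \<in> V n - V (n - 1). e\<^sub>n \<in> D ` homog h 0))"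

text \<open>
  \<open>(t, Bt)\<close> is the generalized odd double extension of \<open>(h, B)\<close> by the odd line spanned by \<open>e\<close>
  by means of \<open>D\<close>, \<open>X0\<close>, \<open>l0\<close>, with \<open>e'\<close> in the role of $e^*$. The direct sum is internal.
  Brackets and form values that are not listed are determined by (skew-)supersymmetry,
  bilinearity and oddness, which are part of \<open>odd_quadratic t Bt\<close>.
\<close>

definition gen_odd_double_extension ::
    "'b superalg \<Rightarrow> ('b \<Rightarrow> 'b \<Rightarrow> 'a) \<Rightarrow> ('b \<Rightarrow> 'b) \<Rightarrow> 'b \<Rightarrow> 'a \<Rightarrow> 'b \<Rightarrow> 'b \<Rightarrow>
     'b superalg \<Rightarrow> ('b \<Rightarrow> 'b \<Rightarrow> 'a) \<Rightarrow> bool"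
  where "gen_odd_double_extension h B D X0 l0 e e' t Bt \<longleftrightarrow>
    double_extension_data h B D X0 \<and> odd_quadratic t Bt \<and>
    (\<forall>a b. \<forall>X\<in>superspace_of h. a *s e + X + b *s e' = 0 \<longrightarrow> a = 0 \<and> X = 0 \<and> b = 0) \<and>
    homog t 0 = {X + b *s e' | X b. X \<in> homog h 0} \<and>
    homog t 1 = {a *s e + X | a X. X \<in> homog h 1} \<and>
    brk t e e = X0 + l0 *s e' \<and>
    (\<forall>i. \<forall>X\<in>homog h i. brk t e X = D X - (psign i * B X X0) *s e') \<and>
    (\<forall>X\<in>superspace_of h. \<forall>Y\<in>superspace_of h. brk t X Y = brk h X Y + B (D X) Y *s e') \<and>
    (\<forall>T\<in>superspace_of t. brk t e' T = 0) \<and>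
    (\<forall>X\<in>superspace_of h. \<forall>Y\<in>superspace_of h. Bt X Y = B X Y) \<and>
    Bt e e' = 1 \<and>
    (\<forall>X\<in>superspace_of h. Bt X e = 0 \<and> Bt X e' = 0)"

definition orthogonal_direct_sum ::
    "'b superalg \<Rightarrow> ('b \<Rightarrow> 'b \<Rightarrow> 'a) \<Rightarrow> 'b superalg \<Rightarrow> ('b \<Rightarrow> 'b \<Rightarrow> 'a) \<Rightarrow>
     'b superalg \<Rightarrow> ('b \<Rightarrow> 'b \<Rightarrow> 'a) \<Rightarrow> bool"
  where "orthogonal_direct_sum g1 B1 g2 B2 g B \<longleftrightarrow>
    odd_quadratic g1 B1 \<and> odd_quadratic g2 B2 \<and> odd_quadratic g B \<and>
    superspace_of g1 \<inter> superspace_of g2 = {0} \<and>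
    (\<forall>i. homog g i = {X + Y | X Y. X \<in> homog g1 i \<and> Y \<in> homog g2 i}) \<and>
    (\<forall>X\<in>superspace_of g1. \<forall>Y\<in>superspace_of g1. brk g X Y = brk g1 X Y \<and> B X Y = B1 X Y) \<and>
    (\<forall>X\<in>superspace_of g2. \<forall>Y\<in>superspace_of g2. brk g X Y = brk g2 X Y \<and> B X Y = B2 X Y) \<and>
    (\<forall>X\<in>superspace_of g1. \<forall>Y\<in>superspace_of g2. brk g X Y = 0 \<and> B X Y = 0)"

definition isometric ::
    "'b superalg \<Rightarrow> ('b \<Rightarrow> 'b \<Rightarrow> 'a) \<Rightarrow> 'b superalg \<Rightarrow> ('b \<Rightarrow> 'b \<Rightarrow> 'a) \<Rightarrow> bool"
  where "isometric g B g' B' \<longleftrightarrow>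
    odd_quadratic g B \<and> odd_quadratic g' B' \<and>
    (\<exists>f. linear_map_on (superspace_of g) scale f \<and>
      bij_betw f (superspace_of g) (superspace_of g') \<and>
      (\<forall>i. f ` homog g i = homog g' i) \<and>
      (\<forall>X\<in>superspace_of g. \<forall>Y\<in>superspace_of g.
        f (brk g X Y) = brk g' (f X) (f Y) \<and> B' (f X) (f Y) = B X Y))"

text \<open>
  The odd-quadratic Lie superalgebras obtained from \<open>(b, Bb)\<close> by finitely many generalized odd
  double extensions and orthogonal direct sums, up to isometric isomorphism. The rule \<open>iso\<close> also
  makes direct sums of copies of one algebra available although the sums are internal.
\<close>

inductive obtained_from ::
    "'b superalg \<Rightarrow> ('b \<Rightarrow> 'b \<Rightarrow> 'a) \<Rightarrow> 'b superalg \<Rightarrow> ('b \<Rightarrow> 'b \<Rightarrow> 'a) \<Rightarrow> bool"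
  for b :: "'b superalg" and Bb :: "'b \<Rightarrow> 'b \<Rightarrow> 'a"
where
  base: "obtained_from b Bb b Bb"
| extension: "\<lbrakk>obtained_from b Bb h B; gen_odd_double_extension h B D X0 l0 e e' t Bt\<rbrakk>
    \<Longrightarrow> obtained_from b Bb t Bt"
| direct_sum: "\<lbrakk>obtained_from b Bb g1 B1; obtained_from b Bb g2 B2;
      orthogonal_direct_sum g1 B1 g2 B2 g B\<rbrakk> \<Longrightarrow> obtained_from b Bb g B"
| iso: "\<lbrakk>obtained_from b Bb g B; isometric g B g' B'\<rbrakk> \<Longrightarrow> obtained_from b Bb g' B'"

definition six_dim_weak_filiform :: "'b superalg \<Rightarrow> ('b \<Rightarrow> 'b \<Rightarrow> 'a) \<Rightarrow> bool"
  where "six_dim_weak_filiform b B \<longleftrightarrow>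
    odd_quadratic b B \<and> dim (superspace_of b) = 6 \<and>
    (\<exists>V X\<^sub>1 X\<^sub>2 X\<^sub>3 e\<^sub>3 v\<^sub>2 u\<^sub>2. weak_filiform_flag b V \<and>
      basis_of (homog b 0) [X\<^sub>1, X\<^sub>2, X\<^sub>3] \<and>
      basis_of (homog b 1) [e\<^sub>3, v\<^sub>2, u\<^sub>2] \<and>
      basis_of (V 2) [v\<^sub>2, u\<^sub>2])"

end

end

theory Submission
  imports Defs
begin

text \<open>
  The proof peels off one hyperbolic pair at a time. Let $m = \dim \mathfrak g_{\bar 1} > 3$, with
  flag $V_m \supset V_{m-1} \supset \dots$. Since the form pairs $\mathfrak g_{\bar 0}$ perfectly
  with $\mathfrak g_{\bar 1}$, the two parts have the same dimension
  (\<open>dim_even_eq_dim_odd\<close>), and the hyperplane $V_{m-1} = [\mathfrak g_{\bar 0}, \mathfrak g_{\bar 1}]$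
  is annihilated by some even $e^* \neq 0$. By invariance such an element is central
  (\<open>central_if_orthogonal\<close>). Non-degeneracy provides an odd $e$ with $B(e, e^*) = 1$
  (\<open>central_hyperbolic_pair_exists\<close>).

  Because $e^*$ is central, its orthogonal space $\mathfrak h \oplus \mathbb K e^*$, where
  $\mathfrak h = \{e, e^*\}^\perp$, is an ideal containing all brackets, and $\mathfrak h$ with the
  bracket projected along $e^*$ is again odd-quadratic (\<open>odd_quadratic_reduction\<close>).
  Decomposing the brackets of $\mathfrak g$ with respect to
  $\mathbb K e \oplus \mathfrak h \oplus \mathbb K e^*$ shows that $\mathfrak g$ is the generalized odd
  double extension of $\mathfrak h$ by $D = [e, \cdot]$ and $X_0 = [e, e]$, both projected to
  $\mathfrak h$ (\<open>gen_odd_double_extension_of_reduction\<close>): the coefficients of $e^*$ are values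
  $B(e, \cdot)$, which invariance rewrites in terms of $D$ and $X_0$, and the conditions on $D$ and
  $X_0$ are instances of the Jacobi identity involving $e$.

  Finally $\mathfrak h_{\bar 1} = V_{m-1}$ and $\mathfrak h_{\bar 0}$ acts on it as
  $\mathfrak g_{\bar 0}$ does, so that $V_{m-1} \supset \dots \supset V_2$ is a flag for $\mathfrak h$
  (\<open>weak_filiform_flag_reduction\<close>). The descent ends at $m = 3$, where the algebra is
  $6$-dimensional. Every algebra in the sequence is a subspace of $\mathfrak g$ with the restricted
  form and a bracket obtained from that of $\mathfrak g$ by projection.
\<close>

section \<open>Linear algebra with finite-dimensional subspaces\<close>

context superalg_space
begin

lemma subspace_finite_basis:
  assumes "subspace W" "W \<subseteq> span S" "finite S"
  obtains T where "finite T" "independent T" "T \<subseteq> W" "span T = W" "card T = dim W"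
proof -
  obtain T where T: "T \<subseteq> W" "independent T" "W \<subseteq> span T" "card T = dim W"
    by (rule basis_exists)
  have "finite T"
    using independent_span_bound[OF assms(3) T(2)] T(1) assms(2) by auto
  moreover have "span T = W"
    using T assms(1) by (intro span_subspace) auto
  ultimately show ?thesis using that T by blast
qed

lemma line_plus_hyperplane:
  assumes W: "subspace W" "W \<subseteq> V" and V: "subspace V" "V \<subseteq> span S" "finite S"
    and "dim V \<le> Suc (dim W)" and e: "e \<in> V" "e \<notin> W" and "x \<in> V"
  obtains a w where "w \<in> W" "x = a *s e + w"
proof -
  obtain T where T: "finite T" "independent T" "T \<subseteq> W" "span T = W" "card T = dim W"
    using subspace_finite_basis[of W S] assms by (metis order_trans)
  obtain U where U: "finite U" "independent U" "span U = V" "card U = dim V"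
    using subspace_finite_basis[of V S] assms by metis
  have eT: "e \<notin> span T" "e \<notin> T" using T e(2) by auto
  have "x \<in> span (insert e T)"
  proof (rule ccontr)
    assume x: "x \<notin> span (insert e T)"
    then have "x \<notin> insert e T" using span_base by blast
    moreover have "independent (insert x (insert e T))"
      using x eT T by (intro independent_insertI) auto
    then have "card (insert x (insert e T)) \<le> card U"
      using independent_span_bound[OF U(1), of "insert x (insert e T)"] U T W e(1) assms(9) by blast
    ultimately show False using T eT U assms(6) by auto
  qed
  then obtain a where "x - a *s e \<in> W"
    unfolding span_breakdown_eq using T by auto
  then show ?thesis using that[of "x - a *s e" a] by auto
qed

text \<open>
  Each linear condition lowers the dimension by at most one: two vectors outside the kernel are
  proportional modulo the kernel.
\<close>

lemma dim_le_annihilator: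
  assumes S: "finite S"
    and P: "subspace P" "P \<subseteq> span F" "finite F"
    and f: "\<And>q. q \<in> S \<Longrightarrow> linear_map_on P (*) (f q)"
  shows "dim P \<le> dim {p \<in> P. \<forall>q\<in>S. f q p = 0} + card S"
  using S f
proof (induction S)
  case empty
  then show ?case by simp
next
  case (insert q S)
  let ?K = "{p \<in> P. \<forall>q\<in>S. f q p = 0}"
  let ?L = "{p \<in> P. \<forall>q\<in>insert q S. f q p = 0}"
  have add: "f r (x + y) = f r x + f r y" if "r \<in> insert q S" "x \<in> P" "y \<in> P" for r x y
    using insert.prems[OF that(1)] that unfolding linear_map_on_def by blast
  have scl: "f r (c *s x) = c * f r x" if "r \<in> insert q S" "x \<in> P" for r c x
    using insert.prems[OF that(1)] that unfolding linear_map_on_def by blast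
  have sub: "subspace {p \<in> P. \<forall>q\<in>A. f q p = 0}" if A: "A \<subseteq> insert q S" for A
  proof (rule subspaceI)
    have "f r 0 = 0" if "r \<in> A" for r
      using scl[of r 0 0] that A subspace_0[OF P(1)] by auto
    then show "0 \<in> {p \<in> P. \<forall>q\<in>A. f q p = 0}"
      using subspace_0[OF P(1)] by auto
  next
    fix x y assume "x \<in> {p \<in> P. \<forall>q\<in>A. f q p = 0}" "y \<in> {p \<in> P. \<forall>q\<in>A. f q p = 0}"
    then show "x + y \<in> {p \<in> P. \<forall>q\<in>A. f q p = 0}"
      using A by (auto simp: add subset_iff intro: subspace_add[OF P(1)])
  next
    fix c x assume "x \<in> {p \<in> P. \<forall>q\<in>A. f q p = 0}"
    then show "c *s x \<in> {p \<in> P. \<forall>q\<in>A. f q p = 0}"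
      using A by (auto simp: scl subset_iff intro: subspace_scale[OF P(1)])
  qed
  have "dim ?K \<le> Suc (dim ?L)"
  proof (cases "?K = ?L")
    case True
    then show ?thesis by simp
  next
    case False
    then obtain p where p: "p \<in> ?K" "f q p \<noteq> 0" by blast
    obtain T where T: "finite T" "span T = ?L" "card T = dim ?L"
    proof (rule subspace_finite_basis[OF sub[OF order_refl] _ P(3)])
      show "?L \<subseteq> span F" using P(2) by auto
    qed
    have "?K \<subseteq> span (insert p T)"
    proof
      fix x assume x: "x \<in> ?K"
      let ?a = "f q x / f q p"
      have K: "x + (- ?a) *s p \<in> ?K"
        using subspace_add[OF sub[of S] x subspace_scale[OF sub[of S] p(1)]] by blast
      have "f q (x + (- ?a) *s p) = f q x + (- ?a) * f q p"
        using x p subspace_scale[OF P(1)] by (simp add: add scl del: scale_minus_left)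
      then have "x + (- ?a) *s p \<in> ?L" using K p(2) by auto
      then show "x \<in> span (insert p T)"
        unfolding span_breakdown_eq T(2)[symmetric] by (intro exI[of _ ?a]) simp
    qed
    then have "dim ?K \<le> card (insert p T)"
      using T by (intro dim_le_card) auto
    also have "\<dots> \<le> Suc (card T)" by (simp add: card_insert_if T)
    finally show ?thesis using T by simp
  qed
  moreover have "dim P \<le> dim ?K + card S" using insert by simp
  ultimately show ?case using insert.hyps by simp
qed

lemma independent_Un_if_disjoint_spans:
  assumes "finite S" "independent S" "independent T" "span S \<inter> span T = {0}"
  shows "independent (S \<union> T)"
  using assms
proof (induction S)
  case empty
  then show ?case by simp
next
  case (insert u S)
  have S: "independent S" "u \<notin> span S"
    using insert.prems(1) insert.hyps(2) by (auto simp: independent_insert)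
  have mono: "span S \<subseteq> span (insert u S)" by (rule span_mono) blast
  have "u \<notin> span (S \<union> T)"
  proof
    assume "u \<in> span (S \<union> T)"
    then obtain a b where ab: "a \<in> span S" "b \<in> span T" "u = a + b"
      unfolding span_Un by blast
    have "u - a \<in> span (insert u S)"
      using mono ab(1) span_base[of u "insert u S"] by (intro span_diff) auto
    then have "b = 0" using insert.prems(3) ab by auto
    then show False using ab S by simp
  qed
  moreover have "span S \<inter> span T = {0}"
    using insert.prems(3) mono span_zero by blast
  then have "independent (S \<union> T)" using insert.IH S insert.prems(2) by blast
  ultimately show ?case by (simp add: independent_insertI)
qed

lemma bilinear_map_on_subset:
  "bilinear_map_on S s f \<Longrightarrow> T \<subseteq> S \<Longrightarrow> bilinear_map_on T s f"
  unfolding bilinear_map_on_def linear_map_on_def by blast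

lemma flag_top:
  "weak_filiform_flag g V \<Longrightarrow> V (dim (homog g 1)) = homog g 1"
  unfolding weak_filiform_flag_def by blast

lemma flag_step:
  assumes "weak_filiform_flag g V" "2 \<le> i" "i \<le> dim (homog g 1)"
  shows "subspace (V i)" and "dim (V i) = i" and "V (i - 1) \<subset> V i"
    and "span {brk g X v | X v. X \<in> homog g 0 \<and> v \<in> V i} = V (i - 1)"
proof -
  have i: "i \<in> {2..dim (homog g 1)}" using assms by simp
  have "subspace (V i) \<and> dim (V i) = i \<and> V (i - 1) \<subset> V i \<and>
      span {brk g X v | X v. X \<in> homog g 0 \<and> v \<in> V i} = V (i - 1)"
    using assms(1) i unfolding weak_filiform_flag_def by (elim conjE) (erule bspec)
  then show "subspace (V i)" "dim (V i) = i" "V (i - 1) \<subset> V i"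
    "span {brk g X v | X v. X \<in> homog g 0 \<and> v \<in> V i} = V (i - 1)" by simp_all
qed

lemma flag_mono:
  assumes flag: "weak_filiform_flag g V" and ij: "i \<le> j" "1 \<le> i" "j \<le> dim (homog g 1)"
  shows "V i \<subseteq> V j"
  using ij
proof (induction j rule: dec_induct)
  case base
  then show ?case by simp
next
  case (step j)
  then have "V (Suc j - 1) \<subset> V (Suc j)" by (intro flag_step(3)[OF flag]) auto
  then show ?case using step by auto
qed

end

section \<open>Odd-quadratic Lie superalgebras\<close>

locale odd_quadratic_superalg = superalg_space scale
  for scale :: "'a::{alg_closed_field, field_char_0} \<Rightarrow> 'b::ab_group_add \<Rightarrow> 'b" (infixr \<open>*s\<close> 75) +
  fixes g :: "'b superalg" and B :: "'b \<Rightarrow> 'b \<Rightarrow> 'a"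
  assumes odd_quadratic: "odd_quadratic g B"
begin

abbreviation "G \<equiv> superspace_of g"
abbreviation bracket (\<open>\<lbrakk>_,_\<rbrakk>\<close>) where "\<lbrakk>x,y\<rbrakk> \<equiv> brk g x y"

lemma lie: "lie_superalgebra g"
  using odd_quadratic unfolding odd_quadratic_def by blast

lemma subspace_homog: "subspace (homog g i)"
  using lie unfolding lie_superalgebra_def by blast

lemma homog_finite_span: obtains S where "finite S" "span S = homog g i"
  using lie unfolding lie_superalgebra_def by metis

lemma homog_disjoint: "homog g 0 \<inter> homog g 1 = {0}"
  using lie unfolding lie_superalgebra_def by blast

lemma homog_in_G: "x \<in> homog g i \<Longrightarrow> x \<in> G"
proof -
  assume x: "x \<in> homog g i"
  have "x = x + 0" "x = 0 + x" by auto
  then show ?thesis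
    using x subspace_0[OF subspace_homog] unfolding superspace_of_def
    by (cases i) blast+
qed

lemma G_cases:
  assumes "x \<in> G"
  obtains x0 x1 where "x0 \<in> homog g 0" "x1 \<in> homog g 1" "x = x0 + x1"
  using assms unfolding superspace_of_def by blast

lemma subspace_G: "subspace G"
  unfolding superspace_of_def using subspace_sums[OF subspace_homog subspace_homog] .

lemma G_add: "x \<in> G \<Longrightarrow> y \<in> G \<Longrightarrow> x + y \<in> G"
  and G_scale: "x \<in> G \<Longrightarrow> c *s x \<in> G"
  and G_diff: "x \<in> G \<Longrightarrow> y \<in> G \<Longrightarrow> x - y \<in> G"
  using subspace_G subspace_add subspace_scale subspace_diff by auto

lemma bracket_bilinear: "bilinear_map_on G scale (brk g)"
  using lie unfolding lie_superalgebra_def by blast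

lemma form_bilinear: "bilinear_map_on G (*) B"
  using odd_quadratic unfolding odd_quadratic_def by blast

lemma bracket_add_left: "x \<in> G \<Longrightarrow> y \<in> G \<Longrightarrow> z \<in> G \<Longrightarrow> \<lbrakk>x + y, z\<rbrakk> = \<lbrakk>x,z\<rbrakk> + \<lbrakk>y,z\<rbrakk>"
  and bracket_add_right: "x \<in> G \<Longrightarrow> y \<in> G \<Longrightarrow> z \<in> G \<Longrightarrow> \<lbrakk>z, x + y\<rbrakk> = \<lbrakk>z,x\<rbrakk> + \<lbrakk>z,y\<rbrakk>"
  and bracket_scale_left: "x \<in> G \<Longrightarrow> z \<in> G \<Longrightarrow> \<lbrakk>c *s x, z\<rbrakk> = c *s \<lbrakk>x,z\<rbrakk>"
  and bracket_scale_right: "x \<in> G \<Longrightarrow> z \<in> G \<Longrightarrow> \<lbrakk>z, c *s x\<rbrakk> = c *s \<lbrakk>z,x\<rbrakk>"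
  using bracket_bilinear unfolding bilinear_map_on_def linear_map_on_def by auto

lemma form_add_left: "x \<in> G \<Longrightarrow> y \<in> G \<Longrightarrow> z \<in> G \<Longrightarrow> B (x + y) z = B x z + B y z"
  and form_add_right: "x \<in> G \<Longrightarrow> y \<in> G \<Longrightarrow> z \<in> G \<Longrightarrow> B z (x + y) = B z x + B z y"
  and form_scale_left: "x \<in> G \<Longrightarrow> z \<in> G \<Longrightarrow> B (c *s x) z = c * B x z"
  and form_scale_right: "x \<in> G \<Longrightarrow> z \<in> G \<Longrightarrow> B z (c *s x) = c * B z x"
  using form_bilinear unfolding bilinear_map_on_def linear_map_on_def by auto

lemma bracket_diff_left: "x \<in> G \<Longrightarrow> y \<in> G \<Longrightarrow> z \<in> G \<Longrightarrow> \<lbrakk>x - y, z\<rbrakk> = \<lbrakk>x,z\<rbrakk> - \<lbrakk>y,z\<rbrakk>"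
  using bracket_add_left[of "x - y" y z] G_diff by (simp add: algebra_simps)

lemma bracket_diff_right: "x \<in> G \<Longrightarrow> y \<in> G \<Longrightarrow> z \<in> G \<Longrightarrow> \<lbrakk>z, x - y\<rbrakk> = \<lbrakk>z,x\<rbrakk> - \<lbrakk>z,y\<rbrakk>"
  using bracket_add_right[of "x - y" y z] G_diff by (simp add: algebra_simps)

lemma form_diff_left: "x \<in> G \<Longrightarrow> y \<in> G \<Longrightarrow> z \<in> G \<Longrightarrow> B (x - y) z = B x z - B y z"
  using form_add_left[of "x - y" y z] G_diff by (simp add: algebra_simps)

lemma form_diff_right: "x \<in> G \<Longrightarrow> y \<in> G \<Longrightarrow> z \<in> G \<Longrightarrow> B z (x - y) = B z x - B z y"
  using form_add_right[of "x - y" y z] G_diff by (simp add: algebra_simps)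

lemma bracket_homog: "x \<in> homog g i \<Longrightarrow> y \<in> homog g j \<Longrightarrow> \<lbrakk>x,y\<rbrakk> \<in> homog g (i + j)"
  using lie unfolding lie_superalgebra_def by blast

lemma bracket_even_odd: "x \<in> homog g 0 \<Longrightarrow> y \<in> homog g 1 \<Longrightarrow> \<lbrakk>x,y\<rbrakk> \<in> homog g 1"
  and bracket_odd_even: "x \<in> homog g 1 \<Longrightarrow> y \<in> homog g 0 \<Longrightarrow> \<lbrakk>x,y\<rbrakk> \<in> homog g 1"
  and bracket_even_even: "x \<in> homog g 0 \<Longrightarrow> y \<in> homog g 0 \<Longrightarrow> \<lbrakk>x,y\<rbrakk> \<in> homog g 0"
  and bracket_odd_odd: "x \<in> homog g 1 \<Longrightarrow> y \<in> homog g 1 \<Longrightarrow> \<lbrakk>x,y\<rbrakk> \<in> homog g 0"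
  using bracket_homog[of x 0 y 1] bracket_homog[of x 1 y 0]
    bracket_homog[of x 0 y 0] bracket_homog[of x 1 y 1] by simp_all

lemma bracket_G: 
  assumes "x \<in> G" "y \<in> G" shows "\<lbrakk>x,y\<rbrakk> \<in> G"
proof -
  obtain x0 x1 where x: "x0 \<in> homog g 0" "x1 \<in> homog g 1" "x = x0 + x1" using assms G_cases by blast
  obtain y0 y1 where y: "y0 \<in> homog g 0" "y1 \<in> homog g 1" "y = y0 + y1" using assms G_cases by blast
  have "\<lbrakk>x,y\<rbrakk> = (\<lbrakk>x0,y0\<rbrakk> + \<lbrakk>x0,y1\<rbrakk>) + (\<lbrakk>x1,y0\<rbrakk> + \<lbrakk>x1,y1\<rbrakk>)"
    using x y by (simp add: bracket_add_left bracket_add_right homog_in_G G_add)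
  also have "\<dots> \<in> G"
    using x y by (intro G_add) (blast intro: homog_in_G bracket_homog)+
  finally show ?thesis .
qed

lemma bracket_skew:
  "x \<in> homog g i \<Longrightarrow> y \<in> homog g j \<Longrightarrow> \<lbrakk>x,y\<rbrakk> = - psign (i * j) *s \<lbrakk>y,x\<rbrakk>"
  using lie unfolding lie_superalgebra_def by blast

lemma jacobi:
  "x \<in> homog g i \<Longrightarrow> y \<in> homog g j \<Longrightarrow> z \<in> homog g k \<Longrightarrow>
    \<lbrakk>x, \<lbrakk>y,z\<rbrakk>\<rbrakk> = \<lbrakk>\<lbrakk>x,y\<rbrakk>, z\<rbrakk> + psign (i * j) *s \<lbrakk>y, \<lbrakk>x,z\<rbrakk>\<rbrakk>"
  using lie unfolding lie_superalgebra_def by blast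

lemma form_supersym: "x \<in> homog g i \<Longrightarrow> y \<in> homog g j \<Longrightarrow> B x y = psign (i * j) * B y x"
  using odd_quadratic unfolding odd_quadratic_def by blast

lemma form_invariant: "x \<in> G \<Longrightarrow> y \<in> G \<Longrightarrow> z \<in> G \<Longrightarrow> B \<lbrakk>x,y\<rbrakk> z = B x \<lbrakk>y,z\<rbrakk>"
  using odd_quadratic unfolding odd_quadratic_def by blast

lemma form_odd: "x \<in> homog g i \<Longrightarrow> y \<in> homog g i \<Longrightarrow> B x y = 0"
  using odd_quadratic unfolding odd_quadratic_def by blast

lemma form_nondegenerate: "x \<in> G \<Longrightarrow> (\<And>y. y \<in> G \<Longrightarrow> B x y = 0) \<Longrightarrow> x = 0"
  using odd_quadratic unfolding odd_quadratic_def by blast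

text \<open>
  The sign in supersymmetry is negative only for two odd arguments, where an odd form vanishes;
  so the form is symmetric in the ordinary sense.
\<close>

lemma form_sym:
  assumes "x \<in> G" "y \<in> G" shows "B x y = B y x"
proof -
  have h: "B x y = B y x" if "x \<in> homog g i" "y \<in> homog g j" for x y i j
    using form_supersym[OF that] form_odd[of x i y] form_odd[of y i x] that
    by (cases i; cases j) (auto simp: psign_def)
  obtain x0 x1 where x: "x0 \<in> homog g 0" "x1 \<in> homog g 1" "x = x0 + x1" using assms G_cases by blast
  obtain y0 y1 where y: "y0 \<in> homog g 0" "y1 \<in> homog g 1" "y = y0 + y1" using assms G_cases by blast
  show ?thesis
    using x y h[OF x(1) y(1)] h[OF x(1) y(2)] h[OF x(2) y(1)] h[OF x(2) y(2)]
    by (simp add: form_add_left form_add_right homog_in_G G_add)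
qed

text \<open>
  An odd form pairs a homogeneous element only with the opposite parity, so orthogonality to that
  component already forces it to vanish.
\<close>

lemma homog_nondegenerate:
  assumes x: "x \<in> homog g i" and "\<And>y. y \<in> homog g (i + 1) \<Longrightarrow> B x y = 0"
  shows "x = 0"
proof (rule form_nondegenerate)
  show "x \<in> G" using x by (rule homog_in_G)
  fix y assume "y \<in> G"
  then obtain y0 y1 where y: "y0 \<in> homog g 0" "y1 \<in> homog g 1" "y = y0 + y1" using G_cases by blast
  have "B x y = B x y0 + B x y1" using x y by (simp add: form_add_right homog_in_G)
  moreover have "B x y0 = 0" "B x y1 = 0"
    using x assms(2)[of y0] assms(2)[of y1] form_odd[of x i y0] form_odd[of x i y1] y
    by (cases i; simp)+
  ultimately show "B x y = 0" by simp
qed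

lemma form_linear_left: "x \<in> G \<Longrightarrow> S \<subseteq> G \<Longrightarrow> linear_map_on S (*) (B x)"
  unfolding linear_map_on_def by (auto simp: form_add_right form_scale_right subset_iff)

text \<open>
  Orthogonality to a subspace is orthogonality to a basis of it, hence as many linear conditions
  as its dimension.
\<close>

lemma dim_annihilator_ge:
  assumes W: "subspace W" "W \<subseteq> homog g j"
  shows "dim (homog g i) \<le> dim {x \<in> homog g i. \<forall>w\<in>W. B w x = 0} + dim W"
proof -
  obtain S where S: "finite S" "span S = homog g j" by (rule homog_finite_span)
  obtain F where F: "finite F" "span F = homog g i" by (rule homog_finite_span)
  obtain T where T: "finite T" "T \<subseteq> W" "span T = W" "card T = dim W"
    using subspace_finite_basis[OF W(1), of S] W S by metis
  have TG: "t \<in> G" if "t \<in> T" for t using that T W homog_in_G by blast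
  have "B w x = 0" if x: "x \<in> homog g i" and 0: "\<forall>t\<in>T. B t x = 0" and w: "w \<in> W" for x w
  proof -
    have "w \<in> span T" using w T by simp
    then have "w \<in> G \<and> B w x = 0"
    proof (induction rule: span_induct_alt)
      case base
      then show ?case
        using subspace_0[OF subspace_G] form_scale_left[of 0 x 0] homog_in_G[OF x] by simp
    next
      case (step c t y)
      then show ?case
        using 0 TG homog_in_G[OF x] by (simp add: G_add G_scale form_add_left form_scale_left)
    qed
    then show ?thesis ..
  qed
  then have "{x \<in> homog g i. \<forall>w\<in>W. B w x = 0} = {x \<in> homog g i. \<forall>t\<in>T. B t x = 0}"
    using T by blast
  then show ?thesis
    using dim_le_annihilator[OF T(1) subspace_homog[of i], of F B] F T TG form_linear_left homog_in_G
    by (metis order_refl subsetI)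
qed

text \<open>
  By non-degeneracy the annihilator of one parity in the other is zero, which bounds each
  dimension by the other one.
\<close>

lemma dim_even_eq_dim_odd: "dim (homog g 0) = dim (homog g 1)"
proof -
  have "dim (homog g i) \<le> dim (homog g (i + 1))" for i
  proof -
    have "{x \<in> homog g i. \<forall>w\<in>homog g (i + 1). B w x = 0} \<subseteq> {0}"
    proof
      fix x assume "x \<in> {x \<in> homog g i. \<forall>w\<in>homog g (i + 1). B w x = 0}"
      then have x: "x \<in> homog g i" "\<And>w. w \<in> homog g (i + 1) \<Longrightarrow> B w x = 0" by blast+
      have "B x y = 0" if "y \<in> homog g (i + 1)" for y
        using form_sym[OF homog_in_G[OF x(1)] homog_in_G[OF that]] x(2)[OF that] by simp
      then show "x \<in> {0}" using homog_nondegenerate[OF x(1)] by blast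
    qed
    then have "dim {x \<in> homog g i. \<forall>w\<in>homog g (i + 1). B w x = 0} \<le> card ({}::'b set)"
      by (intro dim_le_card) auto
    then show ?thesis
      using dim_annihilator_ge[OF subspace_homog order_refl, of i "i + 1"] by simp
  qed
  from this[of 0] this[of 1] show ?thesis by simp
qed

text \<open>
  Invariance moves the bracket across the form: $B([x,t],y) = B(x,[t,y])$, and for $t$ and $y$ of
  opposite parity $[t,y]$ lies in $[\mathfrak g_{\bar 0}, \mathfrak g_{\bar 1}]$. Pairs of equal
  parity do not occur, because the form is odd and $x$ is even.
\<close>

lemma central_if_orthogonal:
  assumes x: "x \<in> homog g 0" and orth: "\<And>y z. y \<in> homog g 0 \<Longrightarrow> z \<in> homog g 1 \<Longrightarrow> B x \<lbrakk>y,z\<rbrakk> = 0"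
    and "t \<in> G"
  shows "\<lbrakk>x,t\<rbrakk> = 0"
proof -
  obtain t0 t1 where t: "t0 \<in> homog g 0" "t1 \<in> homog g 1" "t = t0 + t1" using assms G_cases by blast
  have "\<lbrakk>x,t0\<rbrakk> = 0"
  proof (rule homog_nondegenerate[of _ 0])
    show "\<lbrakk>x,t0\<rbrakk> \<in> homog g 0" using x t bracket_even_even by simp
    fix y assume "y \<in> homog g (0 + 1)"
    then show "B \<lbrakk>x,t0\<rbrakk> y = 0"
      using form_invariant[of x t0 y] x t orth homog_in_G by auto
  qed
  moreover have "\<lbrakk>x,t1\<rbrakk> = 0"
  proof (rule homog_nondegenerate[of _ 1])
    show "\<lbrakk>x,t1\<rbrakk> \<in> homog g 1" using x t bracket_even_odd by simp
    fix y assume y: "y \<in> homog g (1 + 1)"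
    then have "\<lbrakk>t1,y\<rbrakk> = - psign (1 * 0) *s \<lbrakk>y,t1\<rbrakk>" using bracket_skew[of t1 1 y 0] t by simp
    then show "B \<lbrakk>x,t1\<rbrakk> y = 0"
      using form_invariant[of x t1 y] form_scale_right[of "\<lbrakk>y,t1\<rbrakk>" x "- psign (1 * 0)"]
        x t y orth homog_in_G bracket_G by auto
  qed
  ultimately show ?thesis using x t by (simp add: bracket_add_right homog_in_G)
qed

text \<open>
  The hyperplane $V_{m-1}$ has a nonzero even annihilator by counting dimensions; being
  orthogonal to $V_{m-1} = [\mathfrak g_{\bar 0}, \mathfrak g_{\bar 1}]$, it is central.
\<close>

lemma central_hyperbolic_pair_exists:
  assumes flag: "weak_filiform_flag g V" and m: "m = dim (homog g 1)" "2 < m"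
  obtains e e' where "e \<in> homog g 1" "e' \<in> homog g 0" "B e e' = 1"
    "\<And>t. t \<in> G \<Longrightarrow> \<lbrakk>e', t\<rbrakk> = 0" "\<And>x. x \<in> V (m - 1) \<Longrightarrow> B e' x = 0"
proof -
  have top: "V m = homog g 1" using flag_top[OF flag] m by simp
  have W: "subspace (V (m - 1))" "dim (V (m - 1)) = m - 1"
    using flag_step[OF flag, of "m - 1"] m by auto
  have sub: "V (m - 1) \<subseteq> homog g 1" using flag_step(3)[OF flag, of m] top m by auto
  let ?A = "{x \<in> homog g 0. \<forall>w\<in>V (m - 1). B w x = 0}"
  have "0 < dim ?A"
    using dim_annihilator_ge[OF W(1) sub, of 0] W(2) m dim_even_eq_dim_odd by simp
  \<comment> \<open>\<open>span {}\<close> is the zero space, so the annihilator contains a nonzero vector.\<close>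
  then have "\<not> ?A \<subseteq> span {}"
    using dim_le_card[of ?A "{}"] by auto
  then obtain x where x: "x \<in> ?A" "x \<noteq> 0" by auto
  then obtain y where y: "y \<in> homog g 1" "B x y \<noteq> 0"
    using homog_nondegenerate[of x 0] by auto
  have G: "x \<in> G" "y \<in> G" using x y homog_in_G by blast+
  have orth: "B x w = 0" if "w \<in> V (m - 1)" for w
    using x form_sym[OF G(1), of w] that sub homog_in_G by fastforce
  have bracket_sub: "\<lbrakk>X,v\<rbrakk> \<in> V (m - 1)" if "X \<in> homog g 0" "v \<in> homog g 1" for X v
  proof -
    have "span {\<lbrakk>X,v\<rbrakk> | X v. X \<in> homog g 0 \<and> v \<in> homog g 1} = V (m - 1)"
      using flag_step(4)[OF flag, of m] m top by simp
    moreover have "\<lbrakk>X,v\<rbrakk> \<in> span {\<lbrakk>X,v\<rbrakk> | X v. X \<in> homog g 0 \<and> v \<in> homog g 1}"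
      by (rule span_base) (use that in blast)
    ultimately show ?thesis by simp
  qed
  have central: "\<lbrakk>x, t\<rbrakk> = 0" if t: "t \<in> G" for t
  proof (rule central_if_orthogonal[OF _ _ t])
    show "x \<in> homog g 0" using x by blast
  qed (rule orth[OF bracket_sub])
  show ?thesis
  proof
    show "(1 / B x y) *s y \<in> homog g 1" using subspace_scale[OF subspace_homog] y by blast
    show "x \<in> homog g 0" using x by blast
    show "B ((1 / B x y) *s y) x = 1"
      using G y form_sym[of x y] by (simp add: form_scale_left)
  qed (use central orth in auto)
qed

text \<open>
  Both parts have dimension three, and an odd vector outside $V_2$ completes a basis of $V_2$ to
  one of the odd part.
\<close>

lemma six_dim_weak_filiform_if_dim_odd_3:
  assumes flag: "weak_filiform_flag g V" and 3: "dim (homog g 1) = 3"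
  shows "six_dim_weak_filiform g B"
proof -
  have top: "V 3 = homog g 1" using flag_top[OF flag] 3 by simp
  have V2: "subspace (V 2)" "dim (V 2) = 2" "V 2 \<subset> homog g 1"
    using flag_step[OF flag, of 2] flag_step(3)[OF flag, of 3] 3 top by auto
  obtain S1 where S1: "finite S1" "span S1 = homog g 1" by (rule homog_finite_span)
  obtain S0 where S0: "finite S0" "span S0 = homog g 0" by (rule homog_finite_span)
  have "V 2 \<subseteq> span S1" using V2 S1 by auto
  then obtain T where T: "finite T" "independent T" "T \<subseteq> V 2" "span T = V 2" "card T = dim (V 2)"
    by (rule subspace_finite_basis[OF V2(1) _ S1(1)])
  obtain v u where vu: "T = {v, u}" "v \<noteq> u" using T V2 by (auto simp: card_2_iff)
  obtain w where w: "w \<in> homog g 1" "w \<notin> V 2" using V2 by blast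
  have "span (insert w T) = homog g 1"
  proof (rule span_subspace)
    show "insert w T \<subseteq> homog g 1" using w T V2 by auto
    show "homog g 1 \<subseteq> span (insert w T)"
    proof
      fix x assume x: "x \<in> homog g 1"
      have "V 2 \<subseteq> homog g 1" "homog g 1 \<subseteq> span S1" "dim (homog g 1) \<le> Suc (dim (V 2))"
        using V2 S1 3 by auto
      then obtain a y where "y \<in> V 2" "x = a *s w + y"
        using line_plus_hyperplane[OF V2(1) _ subspace_homog _ S1(1) _ w x] by metis
      then show "x \<in> span (insert w T)"
        unfolding span_breakdown_eq using T by (intro exI[of _ a]) simp
    qed
  qed (rule subspace_homog)
  moreover have "independent (insert w T)" using T w by (intro independent_insertI) auto
  moreover have "w \<notin> T" using w T by blast
  ultimately have odd: "basis_of (homog g 1) [w, v, u]"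
    using vu unfolding basis_of_def by auto
  have "homog g 0 \<subseteq> span S0" using S0 by simp
  then obtain U where U: "finite U" "independent U" "span U = homog g 0" "card U = dim (homog g 0)"
    by (rule subspace_finite_basis[OF subspace_homog _ S0(1)])
  then obtain a b c where abc: "U = {a, b, c}" "a \<noteq> b" "b \<noteq> c" "a \<noteq> c"
    using 3 dim_even_eq_dim_odd by (auto simp: card_3_iff)
  then have even: "basis_of (homog g 0) [a, b, c]"
    using U unfolding basis_of_def by auto
  have disj: "U \<inter> {w, v, u} = {}"
  proof (rule ccontr)
    assume "U \<inter> {w, v, u} \<noteq> {}"
    then obtain x where x: "x \<in> U" "x \<in> {w, v, u}" by blast
    then have "x \<in> span U" "x \<in> span {w, v, u}" using span_base[of x] by auto
    then have "x = 0" using homog_disjoint U(3) odd unfolding basis_of_def by auto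
    then show False using x U dependent_zero by blast
  qed
  have o: "independent {w, v, u}" "span {w, v, u} = homog g 1" "card {w, v, u} = 3"
    using odd unfolding basis_of_def by (auto simp: card_insert_if)
  have "independent (U \<union> {w, v, u})"
    using U o homog_disjoint by (intro independent_Un_if_disjoint_spans) auto
  moreover have "span (U \<union> {w, v, u}) = G"
    unfolding span_Un U(3) o(2) superspace_of_def by blast
  moreover have "card (U \<union> {w, v, u}) = 6"
    using disj U o 3 dim_even_eq_dim_odd by (subst card_Un_disjoint) auto
  ultimately have "dim G = 6" using dim_span_eq_card_independent by metis
  moreover have "basis_of (V 2) [v, u]" using T vu unfolding basis_of_def by auto
  ultimately show ?thesis
    unfolding six_dim_weak_filiform_def using odd_quadratic flag even odd by blast
qed

end

section \<open>Reduction by a central even vector\<close>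

text \<open>
  Here \<open>e'\<close> is $e^*$. The reduction is a model of the quotient of the orthogonal space of
  $\mathbb K e^*$ by $\mathbb K e^*$: the representatives orthogonal to \<open>e\<close> form a complement
  of $\mathbb K e^*$ in it, which keeps the construction inside the given ambient space.
\<close>

locale central_hyperbolic_pair = odd_quadratic_superalg scale g B
  for scale :: "'a::{alg_closed_field, field_char_0} \<Rightarrow> 'b::ab_group_add \<Rightarrow> 'b" (infixr \<open>*s\<close> 75)
    and g B +
  fixes e e' :: 'b
  assumes e_odd: "e \<in> homog g 1" and e'_even: "e' \<in> homog g 0" and form_e_e': "B e e' = 1"
    and e'_central: "t \<in> G \<Longrightarrow> \<lbrakk>e', t\<rbrakk> = 0"
begin

text \<open>
  The coefficient of $e^*$ in a vector orthogonal to $e^*$ is its product with $e$, so this is the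
  bracket followed by the projection onto $\mathfrak h$ along $e^*$. It is also used for brackets
  with $e$, which yields the derivation $D$ and the vector $X_0$.
\<close>

definition reduced_bracket :: "'b \<Rightarrow> 'b \<Rightarrow> 'b"
  where "reduced_bracket X Y = \<lbrakk>X,Y\<rbrakk> - B e \<lbrakk>X,Y\<rbrakk> *s e'"

definition reduction :: "'b superalg"
  where "reduction = \<lparr>homog = \<lambda>i. {X \<in> homog g i. B e X = 0 \<and> B e' X = 0}, brk = reduced_bracket\<rparr>"

abbreviation "H \<equiv> superspace_of reduction"

lemma homog_reduction: "homog reduction i = {X \<in> homog g i. B e X = 0 \<and> B e' X = 0}"
  and brk_reduction: "brk reduction = reduced_bracket"
  by (simp_all add: reduction_def)

lemma e_G: "e \<in> G" and e'_G: "e' \<in> G"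
  using e_odd e'_even homog_in_G by auto

lemma form_e'_e: "B e' e = 1"
  using form_sym[OF e'_G e_G] form_e_e' by simp

lemma form_e_e: "B e e = 0" and form_e'_e': "B e' e' = 0"
  using form_odd e_odd e'_even by auto

text \<open>
  Orthogonality to $e$ is automatic for odd vectors and orthogonality to $e^*$ for even ones, so
  imposing both on the homogeneous components is the same as imposing them on the sum.
\<close>

lemma H_eq: "H = {X \<in> G. B e X = 0 \<and> B e' X = 0}"
proof
  show "H \<subseteq> {X \<in> G. B e X = 0 \<and> B e' X = 0}"
    unfolding superspace_of_def[of reduction] homog_reduction
    by (auto simp: form_add_right homog_in_G e_G e'_G G_add)
  show "{X \<in> G. B e X = 0 \<and> B e' X = 0} \<subseteq> H"
  proof
    fix x assume x: "x \<in> {X \<in> G. B e X = 0 \<and> B e' X = 0}"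
    then obtain x0 x1 where x01: "x0 \<in> homog g 0" "x1 \<in> homog g 1" "x = x0 + x1" using G_cases by blast
    have "B e x1 = 0" "B e' x0 = 0" using form_odd e_odd e'_even x01 by auto
    moreover have "B e x = B e x0 + B e x1" "B e' x = B e' x0 + B e' x1"
      using x01 by (simp_all add: form_add_right homog_in_G e_G e'_G)
    ultimately show "x \<in> H"
      unfolding superspace_of_def[of reduction] homog_reduction using x x01 by auto
  qed
qed

lemma H_G: "x \<in> H \<Longrightarrow> x \<in> G"
  and form_e_H: "x \<in> H \<Longrightarrow> B e x = 0"
  and form_e'_H: "x \<in> H \<Longrightarrow> B e' x = 0"
  by (auto simp: H_eq)

lemma form_H_e: "x \<in> H \<Longrightarrow> B x e = 0"
  and form_H_e': "x \<in> H \<Longrightarrow> B x e' = 0"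
  using form_sym[OF H_G e_G, of x] form_sym[OF H_G e'_G, of x] form_e_H form_e'_H by auto

lemma homog_reduction_homog: "x \<in> homog reduction i \<Longrightarrow> x \<in> homog g i"
  by (auto simp: homog_reduction)

lemma homog_reduction_H: "x \<in> homog reduction i \<Longrightarrow> x \<in> H"
  by (auto simp: homog_reduction H_eq homog_in_G)

lemma central_right: assumes "t \<in> G" shows "\<lbrakk>t, e'\<rbrakk> = 0"
proof -
  have h: "\<lbrakk>x, e'\<rbrakk> = 0" if "x \<in> homog g i" for x i
    using bracket_skew[OF that e'_even] e'_central[OF homog_in_G[OF that]] by simp
  obtain t0 t1 where t: "t0 \<in> homog g 0" "t1 \<in> homog g 1" "t = t0 + t1" using assms G_cases by blast
  show ?thesis using h[OF t(1)] h[OF t(2)] t by (simp add: bracket_add_left homog_in_G e'_G)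
qed

lemma form_e'_bracket: "x \<in> G \<Longrightarrow> y \<in> G \<Longrightarrow> B e' \<lbrakk>x,y\<rbrakk> = 0"
  using form_invariant[OF e'_G, of x y] e'_central[of x] form_scale_left[of 0 y 0]
    subspace_0[OF subspace_G] by simp

lemma reduced_bracket_H: "x \<in> G \<Longrightarrow> y \<in> G \<Longrightarrow> reduced_bracket x y \<in> H"
  unfolding reduced_bracket_def H_eq
  by (simp add: bracket_G G_diff G_scale e_G e'_G form_diff_right form_scale_right
      form_e_e' form_e'_e' form_e'_bracket)

lemma reduced_bracket_G: "x \<in> G \<Longrightarrow> y \<in> G \<Longrightarrow> reduced_bracket x y \<in> G"
  using reduced_bracket_H H_G by blast

lemma bracket_reduced_right: "x \<in> G \<Longrightarrow> y \<in> G \<Longrightarrow> z \<in> G \<Longrightarrow> \<lbrakk>x, reduced_bracket y z\<rbrakk> = \<lbrakk>x, \<lbrakk>y,z\<rbrakk>\<rbrakk>"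
  unfolding reduced_bracket_def
  by (simp add: bracket_diff_right bracket_scale_right central_right bracket_G G_scale e'_G)

lemma bracket_reduced_left: "x \<in> G \<Longrightarrow> y \<in> G \<Longrightarrow> z \<in> G \<Longrightarrow> \<lbrakk>reduced_bracket y z, x\<rbrakk> = \<lbrakk>\<lbrakk>y,z\<rbrakk>, x\<rbrakk>"
  unfolding reduced_bracket_def
  by (simp add: bracket_diff_left bracket_scale_left e'_central bracket_G G_scale e'_G)

lemma form_reduced_left: "x \<in> H \<Longrightarrow> y \<in> G \<Longrightarrow> z \<in> G \<Longrightarrow> B (reduced_bracket y z) x = B \<lbrakk>y,z\<rbrakk> x"
  unfolding reduced_bracket_def
  by (simp add: form_diff_left form_scale_left form_e'_H bracket_G G_scale e'_G H_G)

lemma form_reduced_right: "x \<in> H \<Longrightarrow> y \<in> G \<Longrightarrow> z \<in> G \<Longrightarrow> B x (reduced_bracket y z) = B x \<lbrakk>y,z\<rbrakk>"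
  unfolding reduced_bracket_def
  by (simp add: form_diff_right form_scale_right form_H_e' bracket_G G_scale e'_G H_G)

lemma reduced_bracket_odd: "\<lbrakk>x,y\<rbrakk> \<in> homog g 1 \<Longrightarrow> reduced_bracket x y = \<lbrakk>x,y\<rbrakk>"
  unfolding reduced_bracket_def using form_odd[OF e_odd, of "\<lbrakk>x,y\<rbrakk>"] by simp

lemma reduced_bracket_homog:
  assumes "x \<in> homog g i" "y \<in> homog g j"
  shows "reduced_bracket x y \<in> homog reduction (i + j)"
proof -
  have b: "\<lbrakk>x,y\<rbrakk> \<in> homog g (i + j)" using assms bracket_homog by blast
  have "reduced_bracket x y \<in> homog g (i + j)"
  proof (cases "i + j = 0")
    case True
    have "e' \<in> homog g (i + j)" using e'_even True by metis
    then show ?thesis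
      unfolding reduced_bracket_def
      using b by (intro subspace_diff subspace_scale subspace_homog)
  next
    case False
    then have "i + j = 1" using bit_not_zero_iff by blast
    then show ?thesis using b reduced_bracket_odd by metis
  qed
  moreover have "reduced_bracket x y \<in> H" using assms reduced_bracket_H homog_in_G by blast
  ultimately show ?thesis by (simp add: homog_reduction H_eq)
qed

lemma reduced_bracket_linear:
  assumes "x \<in> G" "y \<in> G" "z \<in> G"
  shows "reduced_bracket z (x + y) = reduced_bracket z x + reduced_bracket z y"
    and "reduced_bracket (x + y) z = reduced_bracket x z + reduced_bracket y z"
    and "reduced_bracket z (c *s x) = c *s reduced_bracket z x"
    and "reduced_bracket (c *s x) z = c *s reduced_bracket x z"
  using assms unfolding reduced_bracket_def
  by (simp_all add: bracket_add_left bracket_add_right bracket_scale_left bracket_scale_right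
      form_add_right form_scale_right bracket_G e_G G_add G_scale algebra_simps)

lemma reduced_bracket_bilinear: "bilinear_map_on G scale reduced_bracket"
  unfolding bilinear_map_on_def linear_map_on_def by (simp add: reduced_bracket_linear)

lemma reduced_bracket_skew:
  assumes "x \<in> homog g i" "y \<in> homog g j"
  shows "reduced_bracket x y = - psign (i * j) *s reduced_bracket y x"
  unfolding reduced_bracket_def bracket_skew[OF assms]
  using form_scale_right[of "\<lbrakk>y,x\<rbrakk>" e "- psign (i * j)"] assms
  by (simp add: bracket_G homog_in_G e_G scale_right_diff_distrib del: scale_minus_left)

text \<open>
  Since $e^*$ is central, the inner projection does not affect the outer bracket. Identities between
  iterated brackets of $\mathfrak g$ therefore survive the projection.
\<close>

lemma reduced_bracket_nested:
  assumes "x \<in> G" "y \<in> G" "z \<in> G"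
  shows "reduced_bracket x (reduced_bracket y z) = \<lbrakk>x, \<lbrakk>y,z\<rbrakk>\<rbrakk> - B e \<lbrakk>x, \<lbrakk>y,z\<rbrakk>\<rbrakk> *s e'"
    and "reduced_bracket (reduced_bracket y z) x = \<lbrakk>\<lbrakk>y,z\<rbrakk>, x\<rbrakk> - B e \<lbrakk>\<lbrakk>y,z\<rbrakk>, x\<rbrakk> *s e'"
  using bracket_reduced_left[OF assms] bracket_reduced_right[OF assms]
  by (simp_all add: reduced_bracket_def[of x "reduced_bracket y z"]
      reduced_bracket_def[of "reduced_bracket y z" x])

lemma reduced_jacobi:
  assumes "x \<in> homog g i" "y \<in> homog g j" "z \<in> homog g k"
  shows "reduced_bracket x (reduced_bracket y z) =
    reduced_bracket (reduced_bracket x y) z + psign (i * j) *s reduced_bracket y (reduced_bracket x z)"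
proof -
  have G: "x \<in> G" "y \<in> G" "z \<in> G" using assms homog_in_G by auto
  show ?thesis
    using G by (simp add: reduced_bracket_nested jacobi[OF assms] form_add_right form_scale_right
        bracket_G G_scale e_G algebra_simps)
qed

lemma subspace_homog_reduction: "subspace (homog reduction i)"
proof (rule subspaceI)
  show "0 \<in> homog reduction i"
    using subspace_0[OF subspace_homog] form_scale_right[of 0 e 0] form_scale_right[of 0 e' 0]
      e_G e'_G subspace_0[OF subspace_G] by (simp add: homog_reduction)
next
  fix x y assume "x \<in> homog reduction i" "y \<in> homog reduction i"
  then show "x + y \<in> homog reduction i"
    by (auto simp: homog_reduction form_add_right homog_in_G e_G e'_G subspace_add[OF subspace_homog])
next
  fix c x assume "x \<in> homog reduction i"
  then show "c *s x \<in> homog reduction i"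
    by (auto simp: homog_reduction form_scale_right homog_in_G e_G e'_G
        subspace_scale[OF subspace_homog])
qed

lemma lie_superalgebra_reduction: "lie_superalgebra reduction"
  unfolding lie_superalgebra_def brk_reduction
proof (intro conjI allI ballI)
  fix i show "subspace (homog reduction i)" by (rule subspace_homog_reduction)
  obtain S where S: "finite S" "span S = homog g i" by (rule homog_finite_span)
  have "homog reduction i \<subseteq> span S" using S(2) homog_reduction_homog by blast
  then obtain T where "finite T" "span T = homog reduction i"
    by (rule subspace_finite_basis[OF subspace_homog_reduction _ S(1)])
  then show "\<exists>S. finite S \<and> span S = homog reduction i" by blast
next
  show "homog reduction 0 \<inter> homog reduction 1 = {0}"
    using homog_disjoint homog_reduction_homog subspace_0[OF subspace_homog_reduction] by blast
next
  show "bilinear_map_on H scale reduced_bracket"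
    using bilinear_map_on_subset[OF reduced_bracket_bilinear] H_G by blast
next
  fix i j X Y assume "X \<in> homog reduction i" "Y \<in> homog reduction j"
  then show "reduced_bracket X Y \<in> homog reduction (i + j)"
    using reduced_bracket_homog homog_reduction_homog by blast
next
  fix i j X Y assume "X \<in> homog reduction i" "Y \<in> homog reduction j"
  then show "reduced_bracket X Y = - psign (i * j) *s reduced_bracket Y X"
    using reduced_bracket_skew homog_reduction_homog by blast
next
  fix i j k X Y Z
  assume "X \<in> homog reduction i" "Y \<in> homog reduction j" "Z \<in> homog reduction k"
  then show "reduced_bracket X (reduced_bracket Y Z) = reduced_bracket (reduced_bracket X Y) Z
      + psign (i * j) *s reduced_bracket Y (reduced_bracket X Z)"
    using reduced_jacobi homog_reduction_homog by blast
qed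

lemma even_decomp:
  assumes "x \<in> homog g 0"
  obtains y b where "y \<in> homog reduction 0" "x = y + b *s e'"
proof -
  let ?y = "x - B e x *s e'"
  have "?y \<in> homog g 0"
    using assms e'_even by (intro subspace_diff subspace_scale subspace_homog)
  moreover have "B e ?y = 0"
    using assms by (simp add: form_diff_right form_scale_right homog_in_G e_G e'_G G_scale form_e_e')
  moreover have "B e' ?y = 0" using form_odd[OF e'_even] calculation(1) .
  ultimately have "?y \<in> homog reduction 0" by (simp add: homog_reduction)
  then show ?thesis using that[of ?y "B e x"] by simp
qed

lemma odd_decomp:
  assumes "x \<in> homog g 1"
  obtains a y where "y \<in> homog reduction 1" "x = a *s e + y"
proof -
  let ?y = "x - B e' x *s e"
  have "?y \<in> homog g 1"
    using assms e_odd by (intro subspace_diff subspace_scale subspace_homog)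
  moreover have "B e' ?y = 0"
    using assms by (simp add: form_diff_right form_scale_right homog_in_G e_G e'_G G_scale form_e'_e)
  moreover have "B e ?y = 0" using form_odd[OF e_odd] calculation(1) .
  ultimately have "?y \<in> homog reduction 1" by (simp add: homog_reduction)
  then show ?thesis using that[of ?y "B e' x"] by simp
qed

text \<open>
  Invariance survives because $e^*$ is orthogonal to $\mathfrak h$, and non-degeneracy because a
  vector of $\mathfrak h$ is already orthogonal to the complement spanned by $e$ and $e^*$.
\<close>

lemma odd_quadratic_reduction: "odd_quadratic reduction B"
  unfolding odd_quadratic_def brk_reduction
proof (intro conjI allI ballI impI)
  show "lie_superalgebra reduction" by (rule lie_superalgebra_reduction)
  show "bilinear_map_on H (*) B"
    using bilinear_map_on_subset[OF form_bilinear] H_G by blast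
next
  fix i j X Y assume "X \<in> homog reduction i" "Y \<in> homog reduction j"
  then show "B X Y = psign (i * j) * B Y X"
    using form_supersym homog_reduction_homog by blast
next
  fix X Y Z assume "X \<in> H" "Y \<in> H" "Z \<in> H"
  then show "B (reduced_bracket X Y) Z = B X (reduced_bracket Y Z)"
    by (simp add: form_reduced_left form_reduced_right form_invariant H_G)
next
  fix i X Y assume "X \<in> homog reduction i" "Y \<in> homog reduction i"
  then show "B X Y = 0" using form_odd homog_reduction_homog by blast
next
  fix X assume X: "X \<in> H" and orth: "\<forall>Y\<in>H. B X Y = 0"
  show "X = 0"
  proof (rule form_nondegenerate)
    show "X \<in> G" using X H_G by blast
    fix y assume "y \<in> G"
    then obtain y0 y1 where y: "y0 \<in> homog g 0" "y1 \<in> homog g 1" "y = y0 + y1" using G_cases by blast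
    obtain z0 b where z0: "z0 \<in> homog reduction 0" "y0 = z0 + b *s e'" using y even_decomp by blast
    obtain z1 a where z1: "z1 \<in> homog reduction 1" "y1 = a *s e + z1" using y odd_decomp by blast
    have "z0 \<in> H" "z1 \<in> H" using z0 z1 homog_reduction_H by auto
    then show "B X y = 0"
      using orth X unfolding y z0 z1
      by (simp add: form_add_right form_scale_right G_add G_scale H_G e_G e'_G form_H_e form_H_e')
  qed
qed

section \<open>Recovering the algebra as a double extension\<close>

definition D :: "'b \<Rightarrow> 'b" where "D = reduced_bracket e"
definition X0 :: 'b where "X0 = reduced_bracket e e"

lemma D_homog: "x \<in> homog g i \<Longrightarrow> D x \<in> homog reduction (i + 1)"
  using reduced_bracket_homog[OF e_odd, of x i] unfolding D_def add.commute[of 1 i] .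

lemma X0_homog: "X0 \<in> homog reduction 0"
  using reduced_bracket_homog[OF e_odd e_odd] unfolding X0_def by simp

text \<open>
  The Jacobi identity for $e,e,e$ reads $3[e,[e,e]] = 0$.
\<close>

lemma bracket_e_e_e: "\<lbrakk>e, \<lbrakk>e,e\<rbrakk>\<rbrakk> = 0"
proof -
  let ?t = "\<lbrakk>e, \<lbrakk>e,e\<rbrakk>\<rbrakk>"
  have "\<lbrakk>\<lbrakk>e,e\<rbrakk>, e\<rbrakk> = - ?t"
    using bracket_skew[OF bracket_odd_odd[OF e_odd e_odd] e_odd] by (simp add: psign_def)
  moreover have "?t + ?t = \<lbrakk>\<lbrakk>e,e\<rbrakk>, e\<rbrakk>"
    using jacobi[OF e_odd e_odd e_odd] by (simp add: psign_def eq_diff_eq)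
  ultimately have "?t + ?t + ?t = 0" by simp
  moreover have "3 *s ?t = ?t + ?t + ?t"
    using scale_left_distrib[of 2 1 ?t] scale_left_distrib[of 1 1 ?t] by simp
  ultimately show ?thesis by simp
qed

lemma D_X0: "D X0 = 0"
  unfolding D_def X0_def using reduced_bracket_nested(1)[OF e_G e_G e_G] bracket_e_e_e
    form_scale_right[of 0 e 0] subspace_0[OF subspace_G] e_G by simp

lemma D_linear: "linear_map_on H scale D"
  using reduced_bracket_bilinear e_G H_G unfolding D_def bilinear_map_on_def linear_map_on_def by auto

text \<open>
  The Jacobi identity for $e,e,x$ with its sign $-1$ brings $[e,[e,x]]$ to both sides.
\<close>

lemma bracket_e_e_half:
  assumes "x \<in> homog g i" shows "\<lbrakk>e, \<lbrakk>e,x\<rbrakk>\<rbrakk> = (1/2) *s \<lbrakk>\<lbrakk>e,e\<rbrakk>, x\<rbrakk>"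
proof -
  have "\<lbrakk>e, \<lbrakk>e,x\<rbrakk>\<rbrakk> = \<lbrakk>\<lbrakk>e,e\<rbrakk>, x\<rbrakk> - \<lbrakk>e, \<lbrakk>e,x\<rbrakk>\<rbrakk>"
    using jacobi[OF e_odd e_odd assms] by (simp add: psign_def)
  then have "\<lbrakk>\<lbrakk>e,e\<rbrakk>, x\<rbrakk> = \<lbrakk>e, \<lbrakk>e,x\<rbrakk>\<rbrakk> + \<lbrakk>e, \<lbrakk>e,x\<rbrakk>\<rbrakk>" by (simp add: eq_diff_eq)
  also have "\<dots> = 2 *s \<lbrakk>e, \<lbrakk>e,x\<rbrakk>\<rbrakk>" using scale_left_distrib[of 1 1 "\<lbrakk>e, \<lbrakk>e,x\<rbrakk>\<rbrakk>"] by simp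
  finally show ?thesis by simp
qed

lemma D_D:
  assumes "x \<in> H" shows "D (D x) = (1/2) *s brk reduction X0 x"
proof -
  obtain x0 x1 where x: "x0 \<in> homog reduction 0" "x1 \<in> homog reduction 1" "x = x0 + x1"
    using assms unfolding superspace_of_def by blast
  have "D (D y) = (1/2) *s brk reduction X0 y" if "y \<in> homog reduction i" for y i
  proof -
    have y: "y \<in> homog g i" "y \<in> G" using that homog_reduction_homog homog_in_G by blast+
    show ?thesis
      unfolding D_def X0_def brk_reduction using y e_G
      by (simp add: reduced_bracket_nested bracket_e_e_half form_scale_right bracket_G
          scale_right_diff_distrib)
  qed
  from this[OF x(1)] this[OF x(2)] show ?thesis
    unfolding D_def X0_def brk_reduction x(3) using x(1,2)
    by (simp add: reduced_bracket_linear reduced_bracket_G e_G H_G homog_reduction_H scale_right_distrib)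
qed

lemma odd_superderivation_D: "odd_superderivation reduction D"
  unfolding odd_superderivation_def
proof (intro conjI allI ballI)
  show "linear_map_on H scale D" by (rule D_linear)
  fix i show "D ` homog reduction i \<subseteq> homog reduction (i + 1)"
    using D_homog homog_reduction_homog by blast
next
  fix i X Y assume X: "X \<in> homog reduction i" and "Y \<in> H"
  then obtain y0 y1 where y: "y0 \<in> homog reduction 0" "y1 \<in> homog reduction 1" "Y = y0 + y1"
    unfolding superspace_of_def by blast
  have "D (reduced_bracket X y) = reduced_bracket (D X) y + psign i *s reduced_bracket X (D y)"
    if "y \<in> homog reduction j" for y j
    using reduced_jacobi[OF e_odd homog_reduction_homog[OF X] homog_reduction_homog[OF that]]
    by (simp add: D_def)
  from this[OF y(1)] this[OF y(2)]
  show "D (brk reduction X Y) = brk reduction (D X) Y + psign i *s brk reduction X (D Y)"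
    unfolding D_def brk_reduction y(3) using y(1,2) X
    by (simp add: reduced_bracket_linear reduced_bracket_G e_G H_G homog_reduction_H scale_right_distrib)
qed

lemma skew_supersymmetric_D: "skew_supersymmetric reduction B D"
  unfolding skew_supersymmetric_def
proof (intro allI ballI)
  fix i X Y assume X: "X \<in> homog reduction i" and Y: "Y \<in> H"
  have G: "X \<in> G" "Y \<in> G" "X \<in> H" using X Y H_G homog_reduction_H by blast+
  have "\<lbrakk>e,X\<rbrakk> = - psign i *s \<lbrakk>X,e\<rbrakk>" using bracket_skew[OF e_odd homog_reduction_homog[OF X]] by simp
  then have "B (D X) Y = - psign i * B \<lbrakk>X,e\<rbrakk> Y"
    unfolding D_def using Y G form_scale_left[of "\<lbrakk>X,e\<rbrakk>" Y "- psign i"]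
    by (simp add: form_reduced_left e_G bracket_G)
  also have "B \<lbrakk>X,e\<rbrakk> Y = B X (D Y)"
    unfolding D_def using G by (simp add: form_invariant form_reduced_right e_G)
  finally show "B (D X) Y = - psign i * B X (D Y)" .
qed

text \<open>
  Otherwise $D$ maps $\mathfrak h_{\bar 0}$ into $U_{n-1} = [\mathfrak h_{\bar 0}, \mathfrak h_{\bar 1}]$.
  As $\mathfrak g_{\bar 1} = \mathbb K e + \mathfrak h_{\bar 1}$ and $e^*$ is central, all of
  $[\mathfrak g_{\bar 0}, \mathfrak g_{\bar 1}]$ would lie in the proper subspace $U_{n-1}$ of
  $\mathfrak h_{\bar 1}$, against the hypothesis.
\<close>

lemma D_hits_top_quotient:
  assumes gen: "homog reduction 1 \<subseteq> span {\<lbrakk>X,v\<rbrakk> | X v. X \<in> homog g 0 \<and> v \<in> homog g 1}"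
    and flag: "weak_filiform_flag reduction U" and n: "n = dim (homog reduction 1)" "n \<ge> 3"
  shows "\<exists>u \<in> U n - U (n - 1). u \<in> D ` homog reduction 0"
proof (rule ccontr)
  assume no: "\<not> ?thesis"
  have Un: "U n = homog reduction 1" using flag n(1) unfolding weak_filiform_flag_def by auto
  have n_mem: "n \<in> {2..dim (homog reduction 1)}" using n by auto
  have U: "U (n - 1) \<subset> U n"
    "span {brk reduction X v | X v. X \<in> homog reduction 0 \<and> v \<in> U n} = U (n - 1)"
    using flag_step[OF flag] n_mem by auto
  have sub: "subspace (U (n - 1))" unfolding U(2)[symmetric] by (rule subspace_span)
  have "\<lbrakk>X,v\<rbrakk> \<in> U (n - 1)" if Xv: "X \<in> homog g 0" "v \<in> homog g 1" for X v
  proof -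
    obtain Y b where Y: "Y \<in> homog reduction 0" "X = Y + b *s e'" using even_decomp Xv by blast
    obtain w a where w: "w \<in> homog reduction 1" "v = a *s e + w" using odd_decomp Xv by blast
    have g: "Y \<in> homog g 0" "w \<in> homog g 1" using Y w homog_reduction_homog by auto
    have "\<lbrakk>Y,w\<rbrakk> = brk reduction Y w"
      using reduced_bracket_odd bracket_even_odd[OF g] by (simp add: brk_reduction)
    also have "\<dots> \<in> U (n - 1)"
      unfolding U(2)[symmetric] using Y w Un by (intro span_base) blast
    finally have 1: "\<lbrakk>Y,w\<rbrakk> \<in> U (n - 1)" .
    have "D Y \<in> U n" using D_homog[OF g(1)] Un by simp
    then have "D Y \<in> U (n - 1)" using no Y(1) by blast
    moreover have "D Y = \<lbrakk>e,Y\<rbrakk>"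
      using reduced_bracket_odd bracket_odd_even[OF e_odd g(1)] by (simp add: D_def)
    moreover have "\<lbrakk>Y,e\<rbrakk> = (- 1) *s \<lbrakk>e,Y\<rbrakk>" using bracket_skew[OF g(1) e_odd] by (simp add: psign_def)
    ultimately have 2: "\<lbrakk>Y,e\<rbrakk> \<in> U (n - 1)" using subspace_scale[OF sub] by metis
    have "\<lbrakk>X,v\<rbrakk> = a *s \<lbrakk>Y,e\<rbrakk> + \<lbrakk>Y,w\<rbrakk>"
      using g unfolding Y(2) w(2)
      by (simp add: bracket_add_left bracket_add_right bracket_scale_left bracket_scale_right
          homog_in_G e_G e'_G G_add G_scale e'_central)
    then show ?thesis using 1 2 subspace_add[OF sub] subspace_scale[OF sub] by simp
  qed
  then have "span {\<lbrakk>X,v\<rbrakk> | X v. X \<in> homog g 0 \<and> v \<in> homog g 1} \<subseteq> U (n - 1)"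
    by (intro span_minimal sub) blast
  then show False using gen U(1) Un by blast
qed

text \<open>
  The parameter $\lambda_0$ is the coefficient of $e^*$ in $[e,e]$. The other coefficients follow from
  invariance: $B(e,[e,X]) = B([e,e],X) = B(X_0,X)$ and $B(e,[X,Y]) = B([e,X],Y) = B(D X,Y)$.
\<close>

lemma gen_odd_double_extension_of_reduction:
  assumes gen: "homog reduction 1 \<subseteq> span {\<lbrakk>X,v\<rbrakk> | X v. X \<in> homog g 0 \<and> v \<in> homog g 1}"
  shows "gen_odd_double_extension reduction B D X0 (B e \<lbrakk>e,e\<rbrakk>) e e' g B"
  unfolding gen_odd_double_extension_def
proof (intro conjI allI ballI impI)
  show "double_extension_data reduction B D X0"
    unfolding double_extension_data_def Let_def
    using odd_quadratic_reduction odd_superderivation_D skew_supersymmetric_D X0_homog D_X0 D_D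
      D_hits_top_quotient[OF gen] by blast
  show "odd_quadratic g B" by (rule odd_quadratic)
next
  fix a b X assume X: "X \<in> H" and 0: "a *s e + X + b *s e' = 0"
  have G: "X \<in> G" using X H_G by blast
  have "B e' (a *s e + X + b *s e') = a" "B e (a *s e + X + b *s e') = b"
    using G X by (simp_all add: form_add_right form_scale_right G_add G_scale e_G e'_G
        form_e_e' form_e'_e form_e_e form_e'_e' form_e_H form_e'_H)
  moreover have "B x 0 = 0" if "x \<in> G" for x
    using form_scale_right[of 0 x 0] subspace_0[OF subspace_G] that by simp
  ultimately show "a = 0" and "b = 0" unfolding 0 using e_G e'_G by auto
  then show "X = 0" using 0 by simp
next
  show "homog g 0 = {X + b *s e' | X b. X \<in> homog reduction 0}"
  proof (intro equalityI subsetI)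
    fix x assume "x \<in> homog g 0"
    then show "x \<in> {X + b *s e' | X b. X \<in> homog reduction 0}" using even_decomp by blast
  next
    fix x assume "x \<in> {X + b *s e' | X b. X \<in> homog reduction 0}"
    then show "x \<in> homog g 0"
      using homog_reduction_homog e'_even subspace_add[OF subspace_homog] subspace_scale[OF subspace_homog]
      by blast
  qed
  show "homog g 1 = {a *s e + X | a X. X \<in> homog reduction 1}"
  proof (intro equalityI subsetI)
    fix x assume "x \<in> homog g 1"
    then show "x \<in> {a *s e + X | a X. X \<in> homog reduction 1}" using odd_decomp by blast
  next
    fix x assume "x \<in> {a *s e + X | a X. X \<in> homog reduction 1}"
    then show "x \<in> homog g 1"
      using homog_reduction_homog e_odd subspace_add[OF subspace_homog] subspace_scale[OF subspace_homog]
      by blast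
  qed
  show "\<lbrakk>e,e\<rbrakk> = X0 + B e \<lbrakk>e,e\<rbrakk> *s e'" unfolding X0_def reduced_bracket_def by simp
next
  fix i X assume X: "X \<in> homog reduction i"
  have H: "X \<in> H" "X \<in> G" using X homog_reduction_H H_G by blast+
  have XX0: "X0 \<in> homog g 0" "X0 \<in> G" using X0_homog homog_reduction_homog homog_in_G by blast+
  have "B e \<lbrakk>e,X\<rbrakk> = B \<lbrakk>e,e\<rbrakk> X" using form_invariant[OF e_G e_G H(2)] by simp
  also have "\<dots> = B X0 X" unfolding X0_def using form_reduced_left[OF H(1) e_G e_G] by simp
  also have "\<dots> = B X X0" using form_sym XX0 H by blast
  \<comment> \<open>For even \<open>X\<close> both sides vanish, for odd \<open>X\<close> the sign is positive.\<close>
  also have "\<dots> = - psign i * B X X0"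
    using form_odd[OF homog_reduction_homog, of X 0 X0] X XX0
    by (cases i) (auto simp: psign_def)
  finally show "\<lbrakk>e,X\<rbrakk> = D X - (psign i * B X X0) *s e'"
    unfolding D_def reduced_bracket_def by simp
next
  fix X Y assume XY: "X \<in> H" "Y \<in> H"
  have "B e \<lbrakk>X,Y\<rbrakk> = B (D X) Y"
    unfolding D_def using XY by (simp add: form_reduced_left form_invariant H_G e_G)
  then show "\<lbrakk>X,Y\<rbrakk> = brk reduction X Y + B (D X) Y *s e'"
    unfolding brk_reduction reduced_bracket_def by simp
next
  fix T assume "T \<in> G" then show "\<lbrakk>e',T\<rbrakk> = 0" by (rule e'_central)
next
  show "B e e' = 1" by (rule form_e_e')
  fix X assume "X \<in> H"
  then show "B X e = 0" "B X e' = 0" using form_H_e form_H_e' by auto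
qed (rule refl)

section \<open>The flag of the reduction and the descent\<close>

text \<open>
  An odd vector is $a e + w$ with $w \in V_{m-1}$, because $e$ lies outside this hyperplane, and its
  product with $e^*$ is $a$.
\<close>

lemma reduction_odd_part:
  assumes flag: "weak_filiform_flag g V" and m: "m = dim (homog g 1)" "2 < m"
    and orth: "\<And>x. x \<in> V (m - 1) \<Longrightarrow> B e' x = 0"
  shows "homog reduction 1 = V (m - 1)"
proof
  have top: "V m = homog g 1" using flag_top[OF flag] m by simp
  have W: "subspace (V (m - 1))" "dim (V (m - 1)) = m - 1"
    using flag_step[OF flag, of "m - 1"] m by auto
  have sub: "V (m - 1) \<subseteq> homog g 1" using flag_step(3)[OF flag, of m] top m by auto
  then show "V (m - 1) \<subseteq> homog reduction 1"
    using orth form_odd[OF e_odd] by (auto simp: homog_reduction)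
  show "homog reduction 1 \<subseteq> V (m - 1)"
  proof
    fix x assume "x \<in> homog reduction 1"
    then have x: "x \<in> homog g 1" "B e' x = 0" by (auto simp: homog_reduction)
    obtain S where S: "finite S" "span S = homog g 1" by (rule homog_finite_span)
    have "e \<notin> V (m - 1)" using orth form_e'_e by force
    moreover have "homog g 1 \<subseteq> span S" "dim (homog g 1) \<le> Suc (dim (V (m - 1)))"
      using S W m by auto
    ultimately obtain a w where w: "w \<in> V (m - 1)" "x = a *s e + w"
      using line_plus_hyperplane[OF W(1) sub subspace_homog _ S(1) _ e_odd _ x(1)] by metis
    have "w \<in> G" using w(1) sub homog_in_G by blast
    then have "B e' x = a"
      unfolding w(2) using orth[OF w(1)]
      by (simp add: form_add_right form_scale_right e_G e'_G G_scale form_e'_e)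
    then show "x \<in> V (m - 1)" using w x by simp
  qed
qed

text \<open>
  The reduced bracket agrees with the original one on pairs of opposite parity, since there the
  bracket is odd; and passing from $\mathfrak h_{\bar 0}$ to
  $\mathfrak g_{\bar 0} = \mathfrak h_{\bar 0} \oplus \mathbb K e^*$ adds no new brackets.
\<close>

lemma weak_filiform_flag_reduction:
  assumes flag: "weak_filiform_flag g V" and m: "m = dim (homog g 1)" "2 < m"
    and odd_part: "homog reduction 1 = V (m - 1)"
  shows "weak_filiform_flag reduction V"
proof -
  have dim: "dim (homog reduction 1) = m - 1"
    using flag_step(2)[OF flag, of "m - 1"] m odd_part by auto
  have span_eq: "span {brk reduction X v | X v. X \<in> homog reduction 0 \<and> v \<in> V i} = V (i - 1)"
    if i: "2 \<le> i" "i \<le> m - 1" for i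
  proof -
    have Vi: "V i \<subseteq> homog g 1"
      using flag_mono[OF flag, of i m] flag_top[OF flag] i m by simp
    have brk: "reduced_bracket X v = \<lbrakk>X,v\<rbrakk>" if "X \<in> homog g 0" "v \<in> V i" for X v
      using that Vi bracket_even_odd reduced_bracket_odd by blast
    have "{brk reduction X v | X v. X \<in> homog reduction 0 \<and> v \<in> V i}
        = {\<lbrakk>X,v\<rbrakk> | X v. X \<in> homog g 0 \<and> v \<in> V i}"
    proof (intro equalityI subsetI)
      fix z assume "z \<in> {brk reduction X v | X v. X \<in> homog reduction 0 \<and> v \<in> V i}"
      then show "z \<in> {\<lbrakk>X,v\<rbrakk> | X v. X \<in> homog g 0 \<and> v \<in> V i}"
        unfolding brk_reduction using brk homog_reduction_homog by blast
    next
      fix z assume "z \<in> {\<lbrakk>X,v\<rbrakk> | X v. X \<in> homog g 0 \<and> v \<in> V i}"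
      then obtain X v where z: "X \<in> homog g 0" "v \<in> V i" "z = \<lbrakk>X,v\<rbrakk>" by blast
      obtain Y b where Y: "Y \<in> homog reduction 0" "X = Y + b *s e'" using even_decomp z(1) by blast
      have "Y \<in> G" "v \<in> G" using Y(1) z(2) Vi homog_reduction_homog homog_in_G by blast+
      then have "z = \<lbrakk>Y,v\<rbrakk>"
        unfolding z(3) Y(2)
        by (simp add: bracket_add_left bracket_scale_left e'_central e'_G G_scale)
      then show "z \<in> {brk reduction X v | X v. X \<in> homog reduction 0 \<and> v \<in> V i}"
        unfolding brk_reduction using brk[OF homog_reduction_homog[OF Y(1)] z(2)] Y(1) z(2)
        by (intro CollectI exI[of _ Y] exI[of _ v]) simp
    qed
    then show ?thesis using flag_step(4)[OF flag, of i] i m by simp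
  qed
  show ?thesis
    unfolding weak_filiform_flag_def dim
  proof (intro conjI ballI)
    show "V 1 = {0}" using flag unfolding weak_filiform_flag_def by blast
    fix i assume "i \<in> {2..m - 1}"
    then have i: "2 \<le> i" "i \<le> m - 1" "i \<le> dim (homog g 1)" using m by auto
    show "subspace (V i)" "dim (V i) = i" "V (i - 1) \<subset> V i"
      using flag_step[OF flag i(1,3)] by blast+
    show "span {brk reduction X v | X v. X \<in> homog reduction 0 \<and> v \<in> V i} = V (i - 1)"
      using span_eq i by blast
  qed (use m odd_part in auto)
qed

end

context superalg_space
begin

text \<open>
  Induction on the dimension of the odd part: the reduction has the same form and the same flag, with
  the top space removed, so that the starting algebra of the reduction also serves for \<open>g\<close>.
\<close>

lemma obtained_from_six_dim:
  assumes "3 \<le> m" "odd_quadratic g B" "weak_filiform_flag g V" "dim (homog g 1) = m"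
  shows "\<exists>b. six_dim_weak_filiform b B \<and> obtained_from b B g B"
  using assms
proof (induction m arbitrary: g rule: nat_induct_at_least)
  case base
  interpret odd_quadratic_superalg scale g B by unfold_locales (rule base.prems)
  show ?case
    using six_dim_weak_filiform_if_dim_odd_3[OF base.prems(2,3)] obtained_from.base by blast
next
  case (Suc m)
  interpret odd_quadratic_superalg scale g B by unfold_locales (rule Suc.prems)
  have m: "Suc m = dim (homog g 1)" "2 < Suc m" using Suc by auto
  obtain e e' where e: "e \<in> homog g 1" "e' \<in> homog g 0" "B e e' = 1"
    "\<And>t. t \<in> superspace_of g \<Longrightarrow> brk g e' t = 0" and orth: "\<And>x. x \<in> V (Suc m - 1) \<Longrightarrow> B e' x = 0"
    using central_hyperbolic_pair_exists[OF Suc.prems(2) m] by metis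
  interpret central_hyperbolic_pair scale g B e e'
    by unfold_locales (use e in auto)
  have odd_part: "homog reduction 1 = V (Suc m - 1)"
    using reduction_odd_part[OF Suc.prems(2) m] orth by blast
  have flag: "weak_filiform_flag reduction V"
    using weak_filiform_flag_reduction[OF Suc.prems(2) m odd_part] .
  have "dim (homog reduction 1) = m"
    using flag_step(2)[OF Suc.prems(2), of m] Suc.prems(3) Suc.hyps odd_part by simp
  then obtain b where b: "six_dim_weak_filiform b B" "obtained_from b B reduction B"
    using Suc.IH[OF odd_quadratic_reduction flag] by blast
  have "homog reduction 1 = span {brk g X v | X v. X \<in> homog g 0 \<and> v \<in> homog g 1}"
    using flag_step(4)[OF Suc.prems(2), of "Suc m"] flag_top[OF Suc.prems(2)] m odd_part by simp
  then have "gen_odd_double_extension reduction B D X0 (B e (brk g e e)) e e' g B"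
    by (intro gen_odd_double_extension_of_reduction) simp
  then show ?case using b obtained_from.extension by blast
qed

end

theorem corollary4p1:
  fixes scale :: "'k::{alg_closed_field, field_char_0} \<Rightarrow> 'v::ab_group_add \<Rightarrow> 'v"
    and g :: "'v superalg" and B :: "'v \<Rightarrow> 'v \<Rightarrow> 'k"
  assumes "vector_space scale"
    and "superalg_space.odd_quadratic scale g B"
    and "superalg_space.weak_filiform scale g"
    and "vector_space.dim scale (homog g 1) \<ge> 3"
  shows "\<exists>b Bb. superalg_space.six_dim_weak_filiform scale b Bb \<and>
    superalg_space.obtained_from scale b Bb g B"
proof -
  interpret superalg_space scale
    using assms(1) by (simp add: superalg_space_def)
  obtain V where "weak_filiform_flag g V"
    using assms(3) unfolding weak_filiform_def by blast
  then show ?thesis using obtained_from_six_dim[OF assms(4,2)] by blast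
qed

end
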